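(* There are a probability space and, on it, two orthonormal martingale difference sequences $(\varphi^+_n)_{n\ge1}$ and $(\varphi^-_n)_{n\ge1}$ with mutually orthogonal linear spans in $L_2$, such that each has the same distribution as the sequence of Rademacher functions (i.e. each is formed of independent $\{-1,1\}$-valued random variables with mean zero), but such that their union is not a Sidon system. More precisely, the Sidon constant $C_n$ of the union of $\{\varphi^+_k\mid k\le n\}$ and $\{\varphi^-_k\mid k\le n\}$ grows like $\sqrt n$, i.e. there are constants $0<c\le c'<\infty$ such that $c\sqrt n\le C_n\le c'\sqrt n$ for all $n\ge1$.
   Context: Scalars are complex. A system $(\psi_k)$ of bounded functions on a probability space is called Sidon if there is a constant $C$ such that $\sum|x_k|\le C\|\sum x_k\psi_k\|_\infty$ for every finitely supported scalar family $(x_k)$; the smallest such $C$ is its Sidon constant. A sequence $(\varphi_n)_{n\ge1}$ is a martingale difference sequence if there is an increasing sequence of $\sigma$-algebras $(\mathcal A_n)_{n\ge0}$ such that $\varphi_n$ is integrable and $\mathcal A_n$-measurable and $\mathbb E^{\mathcal A_{n-1}}\varphi_n=0$ for all $n\ge1$. *)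

theory Defs
  imports "HOL-Probability.Probability"
begin

definition linf_norm :: "'a measure \<Rightarrow> ('a \<Rightarrow> complex) \<Rightarrow> ereal" where
  "linf_norm M f = esssup M (\<lambda>\<omega>. ereal (cmod (f \<omega>)))"

text \<open>The index set \<open>I\<close> of the system \<open>\<psi>\<close> may be infinite; finitely supported coefficient families
  are given by a finite \<open>F \<subseteq> I\<close> and arbitrary values on \<open>F\<close>. That the members of the system are
  bounded (and measurable) random variables is a standing assumption, not part of the predicate.\<close>

definition sidon_bound :: "'a measure \<Rightarrow> 'i set \<Rightarrow> ('i \<Rightarrow> 'a \<Rightarrow> complex) \<Rightarrow> real \<Rightarrow> bool" where
  "sidon_bound M I \<psi> C \<longleftrightarrow>
     (\<forall>F x. finite F \<and> F \<subseteq> I \<longrightarrow>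
        ereal (\<Sum>k\<in>F. cmod (x k)) \<le> ereal C * linf_norm M (\<lambda>\<omega>. \<Sum>k\<in>F. x k * \<psi> k \<omega>))"

definition sidon_system :: "'a measure \<Rightarrow> 'i set \<Rightarrow> ('i \<Rightarrow> 'a \<Rightarrow> complex) \<Rightarrow> bool" where
  "sidon_system M I \<psi> \<longleftrightarrow> (\<exists>C. sidon_bound M I \<psi> C)"

text \<open>Unspecified unless \<open>\<psi>\<close> is a Sidon system and \<open>I\<close> is nonempty. In that case the minimum is
  attained, see \<open>sidon_constant_least\<close> below.\<close>

definition sidon_constant :: "'a measure \<Rightarrow> 'i set \<Rightarrow> ('i \<Rightarrow> 'a \<Rightarrow> complex) \<Rightarrow> real" where
  "sidon_constant M I \<psi> = (LEAST C. sidon_bound M I \<psi> C)"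

text \<open>The library has conditional expectations of real random variables only; complex ones are taken
  separately in the real and imaginary part.\<close>

definition complex_cond_exp ::
    "'a measure \<Rightarrow> 'a measure \<Rightarrow> ('a \<Rightarrow> complex) \<Rightarrow> 'a \<Rightarrow> complex" where
  "complex_cond_exp M A f = (\<lambda>\<omega>. Complex (real_cond_exp M A (\<lambda>\<omega>. Re (f \<omega>)) \<omega>)
                                          (real_cond_exp M A (\<lambda>\<omega>. Im (f \<omega>)) \<omega>))"

text \<open>Sequences are indexed by \<open>n \<ge> 1\<close>; the value of \<open>\<phi>\<close> at \<open>0\<close> is irrelevant throughout.\<close>

definition martingale_difference_sequence :: "'a measure \<Rightarrow> (nat \<Rightarrow> 'a \<Rightarrow> complex) \<Rightarrow> bool" where
  "martingale_difference_sequence M \<phi> \<longleftrightarrow>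
     (\<exists>A :: nat \<Rightarrow> 'a measure.
        (\<forall>n. subalgebra M (A n)) \<and> (\<forall>m n. m \<le> n \<longrightarrow> sets (A m) \<subseteq> sets (A n)) \<and>
        (\<forall>n\<ge>1. integrable M (\<phi> n) \<and> \<phi> n \<in> borel_measurable (A n) \<and>
           (AE \<omega> in M. complex_cond_exp M (A (n - 1)) (\<phi> n) \<omega> = 0)))"

definition l2_inner :: "'a measure \<Rightarrow> ('a \<Rightarrow> complex) \<Rightarrow> ('a \<Rightarrow> complex) \<Rightarrow> complex" where
  "l2_inner M f g = (LINT \<omega>|M. f \<omega> * cnj (g \<omega>))"

definition orthonormal_system :: "'a measure \<Rightarrow> 'i set \<Rightarrow> ('i \<Rightarrow> 'a \<Rightarrow> complex) \<Rightarrow> bool" where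
  "orthonormal_system M I \<psi> \<longleftrightarrow>
     (\<forall>k\<in>I. \<psi> k \<in> borel_measurable M \<and> integrable M (\<lambda>\<omega>. (cmod (\<psi> k \<omega>))\<^sup>2)) \<and>
     (\<forall>j\<in>I. \<forall>k\<in>I. l2_inner M (\<psi> j) (\<psi> k) = (if j = k then 1 else 0))"

definition linear_span :: "'i set \<Rightarrow> ('i \<Rightarrow> 'a \<Rightarrow> complex) \<Rightarrow> ('a \<Rightarrow> complex) set" where
  "linear_span I \<psi> = {\<lambda>\<omega>. \<Sum>k\<in>F. x k * \<psi> k \<omega> | F x. finite F \<and> F \<subseteq> I}"

definition rademacher_distributed :: "'a measure \<Rightarrow> (nat \<Rightarrow> 'a \<Rightarrow> complex) \<Rightarrow> bool" where
  "rademacher_distributed M \<phi> \<longleftrightarrow>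
     prob_space.indep_vars M (\<lambda>_. borel) \<phi> {1..} \<and>
     (\<forall>n\<ge>1. (\<forall>\<omega>\<in>space M. \<phi> n \<omega> \<in> {-1, 1}) \<and> (LINT \<omega>|M. \<phi> n \<omega>) = 0)"

lemma (in prob_space) sidon_constant_least:
  fixes \<psi> :: "'i \<Rightarrow> 'a \<Rightarrow> complex"
  assumes meas: "\<And>k. k \<in> I \<Longrightarrow> \<psi> k \<in> borel_measurable M"
    and bdd: "\<And>k. k \<in> I \<Longrightarrow> bounded (\<psi> k ` space M)"
    and sid: "sidon_system M I \<psi>" and ne: "I \<noteq> {}"
  shows "sidon_bound M I \<psi> (sidon_constant M I \<psi>)"
    and "sidon_bound M I \<psi> C \<Longrightarrow> sidon_constant M I \<psi> \<le> C"
proof -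
  have fin: "\<exists>r\<ge>0. linf_norm M (\<lambda>\<omega>. \<Sum>k\<in>F. x k * \<psi> k \<omega>) = ereal r" (is "\<exists>r\<ge>0. ?n = _")
    if F: "finite F" "F \<subseteq> I" for F and x :: "'i \<Rightarrow> complex"
  proof -
    let ?f = "\<lambda>\<omega>. \<Sum>k\<in>F. x k * \<psi> k \<omega>"
    have m: "?f \<in> borel_measurable M"
      using F meas by (intro borel_measurable_sum borel_measurable_times) auto
    then have me: "(\<lambda>\<omega>. ereal (cmod (?f \<omega>))) \<in> borel_measurable M"
      by simp
    have "\<forall>k\<in>F. \<exists>B. \<forall>\<omega>\<in>space M. cmod (\<psi> k \<omega>) \<le> B"
      using bdd F by (fastforce simp: bounded_iff)
    then obtain B where B: "\<And>k \<omega>. k \<in> F \<Longrightarrow> \<omega> \<in> space M \<Longrightarrow> cmod (\<psi> k \<omega>) \<le> B k"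
      by metis
    have le: "cmod (?f \<omega>) \<le> (\<Sum>k\<in>F. cmod (x k) * B k)" if "\<omega> \<in> space M" for \<omega>
      using B that
      by (intro order_trans[OF norm_sum] sum_mono) (auto simp: norm_mult intro!: mult_left_mono)
    have up: "?n \<le> ereal (\<Sum>k\<in>F. cmod (x k) * B k)"
      unfolding linf_norm_def using le by (intro esssup_I me AE_I2) simp
    have "esssup M (\<lambda>\<omega>. 0 :: ereal) \<le> ?n"
      unfolding linf_norm_def by (rule esssup_mono) auto
    then have lo: "0 \<le> ?n"
      using esssup_const[of M "0 :: ereal"] by (simp add: emeasure_space_1)
    show ?thesis
      using up lo by (cases ?n) auto
  qed
  let ?S = "{C. sidon_bound M I \<psi> C}"
  have S0: "?S \<noteq> {}"
    using sid by (auto simp: sidon_system_def)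
  have nonneg: "0 \<le> C" if "sidon_bound M I \<psi> C" for C
  proof -
    obtain k where k: "k \<in> I" using ne by auto
    obtain r where r: "r \<ge> 0" "linf_norm M (\<lambda>\<omega>. \<Sum>k\<in>{k}. 1 * \<psi> k \<omega>) = ereal r"
      using fin[of "{k}" "\<lambda>_. 1"] k by auto
    have "ereal (\<Sum>k\<in>{k}. cmod 1) \<le> ereal C * linf_norm M (\<lambda>\<omega>. \<Sum>k\<in>{k}. 1 * \<psi> k \<omega>)"
      using that[unfolded sidon_bound_def, rule_format, of "{k}" "\<lambda>_. 1"] k by simp
    then have "1 \<le> C * r" using r by simp
    then show ?thesis
      using r by (smt (verit) mult_nonpos_nonneg)
  qed
  then have bb: "bdd_below ?S"
    by (auto intro: bdd_belowI[of _ 0])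
  have low: "Inf ?S \<le> C" if "sidon_bound M I \<psi> C" for C
    using that bb by (intro cInf_lower) auto
  have att: "sidon_bound M I \<psi> (Inf ?S)"
  proof (rule sidon_bound_def[THEN iffD2], intro allI impI)
    fix F and x :: "'i \<Rightarrow> complex" assume F: "finite F \<and> F \<subseteq> I"
    then obtain r where r: "r \<ge> 0" "linf_norm M (\<lambda>\<omega>. \<Sum>k\<in>F. x k * \<psi> k \<omega>) = ereal r"
      using fin by blast
    have *: "(\<Sum>k\<in>F. cmod (x k)) \<le> C * r" if "sidon_bound M I \<psi> C" for C
      using that[unfolded sidon_bound_def, rule_format, of F x] F r by simp
    have "(\<Sum>k\<in>F. cmod (x k)) \<le> Inf ?S * r"
    proof (cases "r = 0")
      case True
      then show ?thesis using * S0 by auto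
    next
      case False
      then have "(\<Sum>k\<in>F. cmod (x k)) / r \<le> Inf ?S"
        using * r by (intro cInf_greatest[OF S0]) (auto simp: field_simps)
      then show ?thesis using False r by (simp add: field_simps)
    qed
    then show "ereal (\<Sum>k\<in>F. cmod (x k)) \<le>
        ereal (Inf ?S) * linf_norm M (\<lambda>\<omega>. \<Sum>k\<in>F. x k * \<psi> k \<omega>)"
      using r by simp
  qed
  have eq: "sidon_constant M I \<psi> = Inf ?S"
    unfolding sidon_constant_def by (rule Least_equality) (use att low in auto)
  show "sidon_bound M I \<psi> (sidon_constant M I \<psi>)"
    using att eq by simp
  show "sidon_constant M I \<psi> \<le> C" if "sidon_bound M I \<psi> C"
    using low[OF that] eq by simp
qed

end

theory Submission
  imports Defs
begin

text \<open>
Write \<open>T n\<close> for half the sum of \<open>\<phi>\<^sup>+ k + \<phi>\<^sup>- k\<close> over \<open>k \<le> n\<close>. If \<open>T n\<close> is bounded by a multiple of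
\<open>sqrt n\<close> everywhere, then giving all \<open>2 n\<close> functions the coefficient 1 shows that the Sidon constant is
at least of order \<open>n / sqrt n = sqrt n\<close>. In the other direction any orthonormal system of \<open>2 n\<close>
functions on a probability space has Sidon constant at most \<open>sqrt (2 n)\<close>, by the Cauchy-Schwarz
inequality and since the norm in \<open>L\<^sub>2\<close> is at most the supremum norm (\<open>sidon_bound_orthonormal\<close>).

So the task is to make \<open>T\<close> small. Let \<open>\<phi>\<^sup>+ k\<close> be independent random signs and let \<open>\<phi>\<^sup>- k\<close> be
\<open>\<phi>\<^sup>+ k\<close> on an event \<open>agree k\<close> and \<open>- \<phi>\<^sup>+ k\<close> off it. Then \<open>T\<close> is a walk that makes the step
\<open>\<phi>\<^sup>+ k\<close> on \<open>agree k\<close> and rests otherwise. Choose \<open>agree k\<close> inside the event that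
\<open>\<bar>T (k - 1)\<bar> < 2 sqrt k\<close>: the walk rests whenever it is far out, so \<open>\<bar>T n\<bar> \<le> 2 sqrt n + 1\<close> at every
point (\<open>walk_bound\<close>).

If \<open>agree k\<close> is determined by the past then \<open>\<phi>\<^sup>-\<close> is, like \<open>\<phi>\<^sup>+\<close>, a martingale difference sequence
of signs for one common filtration. This alone makes each of the two a sequence of independent fair
signs and makes their members orthogonal across different indices. What is left is the equal index,
where the inner product of \<open>\<phi>\<^sup>+ k\<close> and \<open>\<phi>\<^sup>- k\<close> is \<open>2 P(agree k) - 1\<close>; so \<open>agree k\<close> must have
probability exactly one half. There is room for that: orthogonality of the steps gives
\<open>E (T n)\<^sup>2 \<le> n\<close>, and then the Chebyshev inequality shows that the event
\<open>\<bar>T (k - 1)\<bar> < 2 sqrt k\<close> has probability at least one half (\<open>prob_calm_walk\<close>). An additional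
coordinate with a continuous law, revealed before all the signs, serves to cut this event down to
probability one half (\<open>ex_halving_cut\<close>).
\<close>

section \<open>Coordinate changes of product measures\<close>

text \<open>It is applied below with \<open>g\<close> the change of sign, which preserves the law of a fair sign.\<close>

lemma (in product_prob_space) distr_PiM_update_coordinate:
  assumes k: "k \<in> I" and g[measurable]: "g \<in> measurable (M k) (M k)"
    and inv: "distr (M k) (M k) g = M k"
  shows "distr (PiM I M) (PiM I M) (\<lambda>\<omega>. fun_upd \<omega> k (g (\<omega> k))) = PiM I M"
proof (rule PiM_eq)
  have upd[measurable]: "(\<lambda>\<omega>. fun_upd \<omega> k (g (\<omega> k))) \<in> measurable (PiM I M) (PiM I M)"
    by (rule measurable_fun_upd[where J = I]) (use k in auto)
  fix J F assume J: "finite J" "J \<subseteq> I" and F: "\<And>j. j \<in> J \<Longrightarrow> F j \<in> sets (M j)"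
  \<comment> \<open>The preimage of a box is the box with the side at \<open>k\<close> replaced by its preimage.\<close>
  define F' where "F' j = (if j = k then g -` F k \<inter> space (M k) else F j)" for j
  have F': "F' j \<in> sets (M j)" if "j \<in> J" for j
    using F[OF that] by (auto simp: F'_def)
  have comp: "\<omega> k \<in> space (M k)" if "\<omega> \<in> space (PiM I M)" for \<omega>
    using that k by (auto simp: space_PiM)
  have "(\<lambda>\<omega>. fun_upd \<omega> k (g (\<omega> k))) -` {\<omega>\<in>space (PiM I M). \<forall>j\<in>J. \<omega> j \<in> F j} \<inter> space (PiM I M)
      = {\<omega>\<in>space (PiM I M). \<forall>j\<in>J. \<omega> j \<in> F' j}"
    using measurable_space[OF upd] comp by (auto simp: F'_def split: if_splits)
  moreover have "prod_emb I M J (Pi\<^sub>E J F) = {\<omega>\<in>space (PiM I M). \<forall>j\<in>J. \<omega> j \<in> F j}"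
    using J by (auto simp: prod_emb_def space_PiM PiE_iff intro: extensional_arb)
  moreover have "prod_emb I M J (Pi\<^sub>E J F) \<in> sets (PiM I M)"
    using J F by (intro sets_PiM_I) auto
  ultimately have "emeasure (distr (PiM I M) (PiM I M) (\<lambda>\<omega>. fun_upd \<omega> k (g (\<omega> k)))) (prod_emb I M J (Pi\<^sub>E J F))
      = emeasure (PiM I M) {\<omega>\<in>space (PiM I M). \<forall>j\<in>J. \<omega> j \<in> F' j}"
    by (simp add: emeasure_distr)
  also have "\<dots> = (\<Prod>j\<in>J. emeasure (M j) (F' j))"
    by (rule emeasure_PiM_Collect) (use J F' in auto)
  also have "\<dots> = (\<Prod>j\<in>J. emeasure (M j) (F j))"
  proof (rule prod.cong)
    fix j assume j: "j \<in> J"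
    have "emeasure (M k) (F' k) = emeasure (distr (M k) (M k) g) (F k)" if "k \<in> J"
      using F[OF that] by (simp add: F'_def emeasure_distr)
    then show "emeasure (M j) (F' j) = emeasure (M j) (F j)"
      using j inv by (cases "j = k") (auto simp: F'_def)
  qed simp
  finally show "emeasure (distr (PiM I M) (PiM I M) (\<lambda>\<omega>. fun_upd \<omega> k (g (\<omega> k)))) (prod_emb I M J (Pi\<^sub>E J F))
      = (\<Prod>j\<in>J. emeasure (M j) (F j))" .
qed simp

section \<open>Martingale differences with values 1 and -1\<close>

text \<open>The filtration is a parameter because two sequences are going to share one. The condition
\<open>fair\<close> is the vanishing of the conditional expectation, tested on the events of the past.\<close>

locale sign_martingale = prob_space M for M :: "'a measure" +
  fixes A :: "nat \<Rightarrow> 'a measure" and s :: "nat \<Rightarrow> 'a \<Rightarrow> real"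
  assumes subalg: "subalgebra M (A n)"
    and filtration: "m \<le> n \<Longrightarrow> sets (A m) \<subseteq> sets (A n)"
    and adapted: "n \<ge> 1 \<Longrightarrow> s n \<in> borel_measurable (A n)"
    and sign: "n \<ge> 1 \<Longrightarrow> \<omega> \<in> space M \<Longrightarrow> s n \<omega> \<in> {-1, 1}"
    and fair: "n \<ge> 1 \<Longrightarrow> E \<in> sets (A (n - 1)) \<Longrightarrow> (\<integral>\<omega>. indicator E \<omega> * s n \<omega> \<partial>M) = 0"
begin

lemma space_A: "space (A n) = space M"
  using subalg[of n] by (simp add: subalgebra_def)

lemma sets_A: "E \<in> sets (A n) \<Longrightarrow> E \<in> sets M"
  using subalg[of n] by (auto simp: subalgebra_def)

lemma measurable_A_mono: "f \<in> borel_measurable (A m) \<Longrightarrow> m \<le> n \<Longrightarrow> f \<in> borel_measurable (A n)"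
  using filtration[of m n] by (auto simp: measurable_def space_A)

lemma measurable_sign: "n \<ge> 1 \<Longrightarrow> s n \<in> borel_measurable M"
  using adapted measurable_from_subalg[OF subalg] by blast

lemma integrable_sign: "n \<ge> 1 \<Longrightarrow> integrable M (s n)"
  using sign[of n] measurable_sign[of n]
  by (intro integrable_const_bound[where B = 1] AE_I2) force+

lemma integral_sign: "n \<ge> 1 \<Longrightarrow> (\<integral>\<omega>. s n \<omega> \<partial>M) = 0"
  using fair[of n "space M"] sets.top[of "A (n - 1)"]
  by (simp add: space_A cong: Bochner_Integration.integral_cong)

text \<open>A function with values in \<open>{-1, 1}\<close> is \<open>2 * indicator E - 1\<close> for an event \<open>E\<close>, so fairness on
events is enough.\<close>

lemma integral_past_sign_mult:
  assumes n: "n \<ge> 1" and g: "g \<in> borel_measurable (A (n - 1))"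
    and gs: "\<And>\<omega>. \<omega> \<in> space M \<Longrightarrow> g \<omega> \<in> {-1, 1}"
  shows "(\<integral>\<omega>. g \<omega> * s n \<omega> \<partial>M) = 0"
proof -
  define E where "E = {\<omega>\<in>space M. g \<omega> = 1}"
  have E: "E \<in> sets (A (n - 1))"
    using measurable_sets[OF g, of "{1}"] by (simp add: E_def space_A vimage_def Int_def conj_commute)
  have i: "integrable M (\<lambda>\<omega>. indicator E \<omega> * s n \<omega>)"
    using integrable_mult_indicator[OF sets_A[OF E] integrable_sign[OF n]] by simp
  have "(\<integral>\<omega>. g \<omega> * s n \<omega> \<partial>M) = (\<integral>\<omega>. 2 * (indicator E \<omega> * s n \<omega>) - s n \<omega> \<partial>M)"
    using gs by (intro Bochner_Integration.integral_cong) (fastforce simp: E_def indicator_def)+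
  also have "\<dots> = 2 * 0 - 0"
    by (subst Bochner_Integration.integral_diff)
      (use i integrable_sign[OF n] fair[OF n E] integral_sign[OF n] in simp_all)
  finally show ?thesis by simp
qed

text \<open>On signs every function is affine, in particular the indicator of \<open>X\<close>; the linear part has
integral zero over any event of the past. This is where the conditional mean alone determines the
conditional law.\<close>

lemma prob_past_Int_sign:
  assumes n: "n \<ge> 1" and G: "G \<in> sets (A (n - 1))"
  shows "prob (G \<inter> (s n -` X \<inter> space M)) = prob G * prob (s n -` X \<inter> space M)"
proof -
  \<comment> \<open>On signs \<open>y\<close> the indicator of \<open>X\<close> is \<open>a + b * y\<close>.\<close>
  define a b :: real where "a = (indicator X 1 + indicator X (-1)) / 2"
    and "b = (indicator X 1 - indicator X (-1)) / 2"
  have *: "prob (H \<inter> (s n -` X \<inter> space M)) = a * prob H" if H: "H \<in> sets (A (n - 1))" for H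
  proof -
    have HM: "H \<in> sets M" by (rule sets_A[OF H])
    have i: "integrable M (\<lambda>\<omega>. indicator H \<omega> * s n \<omega>)"
      using integrable_mult_indicator[OF HM integrable_sign[OF n]] by simp
    have "(\<integral>\<omega>. indicator (H \<inter> (s n -` X \<inter> space M)) \<omega> \<partial>M)
        = (\<integral>\<omega>. a * indicator H \<omega> + b * (indicator H \<omega> * s n \<omega>) \<partial>M)"
    proof (intro Bochner_Integration.integral_cong refl)
      fix \<omega> assume \<omega>: "\<omega> \<in> space M"
      then consider "s n \<omega> = 1" | "s n \<omega> = -1" using sign[OF n] by blast
      then show "indicator (H \<inter> (s n -` X \<inter> space M)) \<omega>
          = a * indicator H \<omega> + b * (indicator H \<omega> * s n \<omega>)"
        using \<omega> by cases (simp_all add: indicator_def a_def b_def)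
    qed
    also have "\<dots> = a * prob H + b * 0"
      by (subst Bochner_Integration.integral_add)
        (use i HM fair[OF n H] sets.sets_into_space[OF HM] in
          \<open>simp_all add: emeasure_eq_measure Int_absorb2\<close>)
    finally show ?thesis
      by (simp add: Int_ac)
  qed
  have "prob (s n -` X \<inter> space M) = a"
    using *[of "space M"] sets.top[of "A (n - 1)"] by (simp add: space_A prob_space Int_ac)
  with *[OF G] show ?thesis by simp
qed

text \<open>The member with the largest index is independent of the event that the others describe, which
belongs to its past; hence the product formula by induction on the largest index.\<close>

lemma indep_signs: "indep_vars (\<lambda>_. borel) s {1..}"
  unfolding indep_vars_def2
proof (intro conjI ballI indep_setsI)
  fix A' J assume J: "J \<noteq> {}" "J \<subseteq> {1..}" "finite J"
    and A': "\<forall>j\<in>J. A' j \<in> {s j -` B \<inter> space M |B. B \<in> sets borel}"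
  have meas: "A' j \<in> sets (A j)" if j: "j \<in> J" for j
  proof -
    obtain B where "B \<in> sets borel" "A' j = s j -` B \<inter> space M" using bspec[OF A' j] by auto
    then show ?thesis using measurable_sets[OF adapted[of j]] J j by (auto simp: space_A)
  qed
  from J(3,1,2) A' meas show "prob (\<Inter>j\<in>J. A' j) = (\<Prod>j\<in>J. prob (A' j))"
  proof (induction J rule: finite_linorder_max_induct)
    case (insert n J)
    show ?case
    proof (cases "J = {}")
      case False
      obtain B where B: "A' n = s n -` B \<inter> space M" using bspec[OF insert.prems(3) insertI1] by auto
      have n: "n \<ge> 1" using insert.prems by auto
      have "A' j \<in> sets (A (n - 1))" if "j \<in> J" for j
      proof -
        have "j \<le> n - 1" using insert.hyps(2) that by fastforce
        then show ?thesis using insert.prems(4)[of j] that filtration[of j "n - 1"] by auto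
      qed
      then have "(\<Inter>j\<in>J. A' j) \<in> sets (A (n - 1))"
        using insert.hyps(1) False by (intro sets.finite_INT) auto
      from prob_past_Int_sign[OF n this, of B] show ?thesis
        using insert B False by (auto simp: Int_commute mult.commute)
    qed simp
  qed simp
qed (use measurable_sign in auto)

lemma martingale_difference_sequence_sign:
  "martingale_difference_sequence M (\<lambda>n \<omega>. complex_of_real (s n \<omega>))"
  unfolding martingale_difference_sequence_def
proof (intro exI[of _ A] conjI allI impI)
  fix n :: nat assume n: "1 \<le> n"
  show "integrable M (\<lambda>\<omega>. complex_of_real (s n \<omega>))"
    using integrable_sign[OF n] by simp
  show "(\<lambda>\<omega>. complex_of_real (s n \<omega>)) \<in> borel_measurable (A n)"
    using adapted[OF n] by simp
  interpret F: finite_measure_subalgebra M "A (n - 1)"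
    by standard (rule subalg)
  have "AE \<omega> in M. real_cond_exp M (A (n - 1)) (s n) \<omega> = 0"
    by (rule F.real_cond_exp_charact)
      (use integrable_sign[OF n] fair[OF n] in \<open>simp_all add: set_lebesgue_integral_def\<close>)
  moreover have "AE \<omega> in M. real_cond_exp M (A (n - 1)) (\<lambda>_. 0) \<omega> = 0"
    by (rule F.real_cond_exp_F_meas) simp_all
  ultimately show "AE \<omega> in M. complex_cond_exp M (A (n - 1)) (\<lambda>\<omega>. complex_of_real (s n \<omega>)) \<omega> = 0"
    by eventually_elim (simp add: complex_cond_exp_def zero_complex.code)
qed (use subalg filtration in auto)

lemma rademacher_distributed_sign: "rademacher_distributed M (\<lambda>n \<omega>. complex_of_real (s n \<omega>))"
  unfolding rademacher_distributed_def
proof (intro conjI allI impI ballI)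
  show "indep_vars (\<lambda>_. borel) (\<lambda>n \<omega>. complex_of_real (s n \<omega>)) {1..}"
    by (rule indep_vars_compose2[OF indep_signs]) simp
qed (use sign integral_sign in \<open>force+\<close>)

end

lemma l2_inner_of_real:
  "l2_inner M (\<lambda>\<omega>. complex_of_real (f \<omega>)) (\<lambda>\<omega>. complex_of_real (g \<omega>)) = of_real (\<integral>\<omega>. f \<omega> * g \<omega> \<partial>M)"
  unfolding l2_inner_def by (simp flip: of_real_mult)

text \<open>For different indices the function with the smaller index belongs to the past of the other one,
whichever of the two sequences they come from, because the filtration is common. Only the products of
equal index from different sequences have to be assumed orthogonal.\<close>

lemma orthonormal_system_sign_pair:
  assumes "sign_martingale M A s" "sign_martingale M A t"
    and diag: "\<And>n. n \<ge> 1 \<Longrightarrow> (\<integral>\<omega>. s n \<omega> * t n \<omega> \<partial>M) = 0"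
  shows "orthonormal_system M ({1..} <+> {1..})
    (case_sum (\<lambda>n \<omega>. complex_of_real (s n \<omega>)) (\<lambda>n \<omega>. complex_of_real (t n \<omega>)))"
proof -
  interpret s: sign_martingale M A s by fact
  interpret t: sign_martingale M A t by fact
  have orth: "(\<integral>\<omega>. u j \<omega> * v k \<omega> \<partial>M) = 0"
    if "sign_martingale M A u" "sign_martingale M A v" "j \<noteq> k" "j \<ge> 1" "k \<ge> 1" for u v and j k :: nat
  proof -
    interpret u: sign_martingale M A u by fact
    interpret v: sign_martingale M A v by fact
    show ?thesis
    proof (cases "j < k")
      case True
      then show ?thesis
        using that by (intro v.integral_past_sign_mult u.measurable_A_mono[OF u.adapted] u.sign) auto
    next
      case False
      then have "(\<integral>\<omega>. v k \<omega> * u j \<omega> \<partial>M) = 0"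
        using that by (intro u.integral_past_sign_mult v.measurable_A_mono[OF v.adapted] v.sign) auto
      then show ?thesis by (simp add: mult.commute)
    qed
  qed
  have norm: "(\<integral>\<omega>. u n \<omega> * u n \<omega> \<partial>M) = 1" if "sign_martingale M A u" "n \<ge> 1" for u and n :: nat
  proof -
    interpret u: sign_martingale M A u by fact
    have "(\<integral>\<omega>. u n \<omega> * u n \<omega> \<partial>M) = (\<integral>\<omega>. 1 \<partial>M)"
      using u.sign[OF that(2)] by (intro Bochner_Integration.integral_cong) force+
    then show ?thesis by (simp add: s.prob_space)
  qed
  have sq: "integrable M (\<lambda>\<omega>. (cmod (complex_of_real (u n \<omega>)))\<^sup>2)"
    if "sign_martingale M A u" "n \<ge> 1" for u and n :: nat
  proof -
    interpret u: sign_martingale M A u by fact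
    show ?thesis
      by (rule s.integrable_const_bound[where B = 1])
        (use u.sign[OF that(2)] u.measurable_sign[OF that(2)] in \<open>force+\<close>)
  qed
  have diag': "(\<integral>\<omega>. t n \<omega> * s n \<omega> \<partial>M) = 0" if "n \<ge> 1" for n
    using diag[OF that] by (simp add: mult.commute)
  show ?thesis
    unfolding orthonormal_system_def
  proof (intro conjI ballI)
    fix k :: "nat + nat" assume k: "k \<in> {1..} <+> {1..}"
    show "case_sum (\<lambda>n \<omega>. complex_of_real (s n \<omega>)) (\<lambda>n \<omega>. complex_of_real (t n \<omega>)) k \<in> borel_measurable M"
      using k s.measurable_sign t.measurable_sign by auto
    show "integrable M (\<lambda>\<omega>. (cmod (case_sum (\<lambda>n \<omega>. complex_of_real (s n \<omega>)) (\<lambda>n \<omega>. complex_of_real (t n \<omega>)) k \<omega>))\<^sup>2)"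
      using k sq[OF assms(1)] sq[OF assms(2)] by auto
    fix j :: "nat + nat" assume j: "j \<in> {1..} <+> {1..}"
    show "l2_inner M (case_sum (\<lambda>n \<omega>. complex_of_real (s n \<omega>)) (\<lambda>n \<omega>. complex_of_real (t n \<omega>)) j)
       (case_sum (\<lambda>n \<omega>. complex_of_real (s n \<omega>)) (\<lambda>n \<omega>. complex_of_real (t n \<omega>)) k) = (if j = k then 1 else 0)"
      using j k norm[OF assms(1)] norm[OF assms(2)] diag diag'
        orth[OF assms(1,1)] orth[OF assms(1,2)] orth[OF assms(2,1)] orth[OF assms(2,2)]
      by (auto simp: l2_inner_of_real; metis)
  qed
qed

section \<open>Sidon bounds and orthonormality\<close>

lemma integrable_mult_cnj:
  fixes f g :: "'a \<Rightarrow> complex"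
  assumes [measurable]: "f \<in> borel_measurable M" "g \<in> borel_measurable M"
    and sq: "integrable M (\<lambda>\<omega>. (cmod (f \<omega>))\<^sup>2)" "integrable M (\<lambda>\<omega>. (cmod (g \<omega>))\<^sup>2)"
  shows "integrable M (\<lambda>\<omega>. f \<omega> * cnj (g \<omega>))"
proof (rule Bochner_Integration.integrable_bound)
  show "integrable M (\<lambda>\<omega>. (cmod (f \<omega>))\<^sup>2 + (cmod (g \<omega>))\<^sup>2)"
    using sq by simp
  have [measurable]: "cnj \<in> borel_measurable borel"
    by (intro borel_measurable_continuous_onI continuous_intros)
  show "(\<lambda>\<omega>. f \<omega> * cnj (g \<omega>)) \<in> borel_measurable M"
    by measurable
  have "a * b \<le> a\<^sup>2 + b\<^sup>2" for a b :: real
    using sum_squares_bound[of a b] sum_power2_ge_zero[of a b] by linarith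
  then show "AE \<omega> in M. norm (f \<omega> * cnj (g \<omega>)) \<le> norm ((cmod (f \<omega>))\<^sup>2 + (cmod (g \<omega>))\<^sup>2)"
    by (intro AE_I2) (simp add: norm_mult)
qed

text \<open>Square integrability of the members is what makes all the products integrable, so that the
double sum may be taken out of the integral.\<close>

lemma l2_inner_sum:
  fixes f :: "'i \<Rightarrow> 'a \<Rightarrow> complex" and g :: "'j \<Rightarrow> 'a \<Rightarrow> complex"
  assumes "\<And>j. j \<in> F \<Longrightarrow> f j \<in> borel_measurable M" "\<And>k. k \<in> G \<Longrightarrow> g k \<in> borel_measurable M"
    and "\<And>j. j \<in> F \<Longrightarrow> integrable M (\<lambda>\<omega>. (cmod (f j \<omega>))\<^sup>2)"
    and "\<And>k. k \<in> G \<Longrightarrow> integrable M (\<lambda>\<omega>. (cmod (g k \<omega>))\<^sup>2)"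
  shows "l2_inner M (\<lambda>\<omega>. \<Sum>j\<in>F. x j * f j \<omega>) (\<lambda>\<omega>. \<Sum>k\<in>G. y k * g k \<omega>)
    = (\<Sum>j\<in>F. \<Sum>k\<in>G. x j * cnj (y k) * l2_inner M (f j) (g k))"
proof -
  have i: "integrable M (\<lambda>\<omega>. f j \<omega> * cnj (g k \<omega>))" if "j \<in> F" "k \<in> G" for j k
    using integrable_mult_cnj[OF assms(1)[OF that(1)] assms(2)[OF that(2)] assms(3)[OF that(1)] assms(4)[OF that(2)]] .
  have "l2_inner M (\<lambda>\<omega>. \<Sum>j\<in>F. x j * f j \<omega>) (\<lambda>\<omega>. \<Sum>k\<in>G. y k * g k \<omega>)
    = (LINT \<omega>|M. (\<Sum>j\<in>F. \<Sum>k\<in>G. x j * cnj (y k) * (f j \<omega> * cnj (g k \<omega>))))"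
    unfolding l2_inner_def by (simp add: sum_product mult_ac)
  also have "\<dots> = (\<Sum>j\<in>F. \<Sum>k\<in>G. (LINT \<omega>|M. x j * cnj (y k) * (f j \<omega> * cnj (g k \<omega>))))"
    using i by (subst Bochner_Integration.integral_sum;
        (intro Bochner_Integration.integrable_sum integrable_mult_right sum.cong refl
          Bochner_Integration.integral_sum)?) auto
  finally show ?thesis
    by (simp add: l2_inner_def)
qed

lemma orthonormal_system_compose:
  assumes "orthonormal_system M I \<psi>" and sub: "f ` J \<subseteq> I" and inj: "inj_on f J"
  shows "orthonormal_system M J (\<lambda>j. \<psi> (f j))"
  unfolding orthonormal_system_def
proof (intro conjI ballI)
  fix k assume k: "k \<in> J"
  then show "\<psi> (f k) \<in> borel_measurable M" "integrable M (\<lambda>\<omega>. (cmod (\<psi> (f k) \<omega>))\<^sup>2)"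
    using assms(1) sub unfolding orthonormal_system_def by blast+
  fix j assume j: "j \<in> J"
  have "f j \<in> I" "f k \<in> I" using j k sub by auto
  then show "l2_inner M (\<psi> (f j)) (\<psi> (f k)) = (if j = k then 1 else 0)"
    using assms(1) inj_on_eq_iff[OF inj j k] unfolding orthonormal_system_def by simp
qed

lemma (in prob_space) linf_norm_nonneg:
  assumes "f \<in> borel_measurable M"
  shows "0 \<le> linf_norm M f"
proof -
  have "esssup M (\<lambda>\<omega>. 0 :: ereal) \<le> linf_norm M f"
    unfolding linf_norm_def by (rule esssup_mono) auto
  then show ?thesis
    using esssup_const[of M "0 :: ereal"] by (simp add: emeasure_space_1)
qed

text \<open>The sum of the \<open>\<bar>x k\<bar>\<close> is at most \<open>sqrt (card I)\<close> times their Euclidean norm, which by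
orthonormality is the norm of the combination in \<open>L\<^sub>2\<close> and so is at most its supremum norm.\<close>

lemma (in prob_space) sidon_bound_orthonormal:
  assumes on: "orthonormal_system M I \<psi>" and I: "finite I"
  shows "sidon_bound M I \<psi> (sqrt (card I))"
  unfolding sidon_bound_def
proof (intro allI impI)
  fix F and x :: "'b \<Rightarrow> complex" assume "finite F \<and> F \<subseteq> I"
  then have F: "finite F" "F \<subseteq> I" by auto
  define f where "f \<omega> = (\<Sum>k\<in>F. x k * \<psi> k \<omega>)" for \<omega>
  have meas: "\<psi> k \<in> borel_measurable M" and sq: "integrable M (\<lambda>\<omega>. (cmod (\<psi> k \<omega>))\<^sup>2)"
    if "k \<in> F" for k
    using on that F by (auto simp: orthonormal_system_def)
  have f[measurable]: "f \<in> borel_measurable M"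
    unfolding f_def using meas by (intro borel_measurable_sum borel_measurable_times) auto
  have l2: "(LINT \<omega>|M. complex_of_real ((cmod (f \<omega>))\<^sup>2)) = of_real (\<Sum>k\<in>F. (cmod (x k))\<^sup>2)"
  proof -
    have "(LINT \<omega>|M. complex_of_real ((cmod (f \<omega>))\<^sup>2)) = l2_inner M f f"
      unfolding l2_inner_def by (intro Bochner_Integration.integral_cong refl) (rule complex_norm_square)
    also have "\<dots> = (\<Sum>j\<in>F. \<Sum>k\<in>F. x j * cnj (x k) * l2_inner M (\<psi> j) (\<psi> k))"
      unfolding f_def by (rule l2_inner_sum) (use meas sq in auto)
    also have "\<dots> = (\<Sum>j\<in>F. \<Sum>k\<in>F. if j = k then x j * cnj (x k) else 0)"
      using on F(2) by (intro sum.cong refl) (auto simp: orthonormal_system_def subset_iff)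
    also have "\<dots> = (\<Sum>j\<in>F. x j * cnj (x j))"
      using F(1) by simp
    finally show ?thesis by (simp only: complex_norm_square of_real_sum)
  qed
  have cs: "(\<Sum>k\<in>F. cmod (x k)) \<le> sqrt (card I) * sqrt (\<Sum>k\<in>F. (cmod (x k))\<^sup>2)"
  proof -
    have "(\<Sum>k\<in>F. cmod (x k))\<^sup>2 \<le> (\<Sum>k\<in>F. (cmod (x k))\<^sup>2) * card F"
      by (rule sum_squared_le_sum_of_squares)
    also have "\<dots> \<le> (\<Sum>k\<in>F. (cmod (x k))\<^sup>2) * card I"
      using card_mono[OF I F(2)] by (intro mult_left_mono) (auto intro: sum_nonneg)
    finally show ?thesis
      using real_le_rsqrt by (fastforce simp: real_sqrt_mult mult.commute)
  qed
  show "ereal (\<Sum>k\<in>F. cmod (x k)) \<le> ereal (sqrt (card I)) * linf_norm M (\<lambda>\<omega>. \<Sum>k\<in>F. x k * \<psi> k \<omega>)"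
  proof (cases "F = {}")
    case True
    then show ?thesis
      using linf_norm_nonneg[of "\<lambda>_. 0"] by (simp add: ereal_0_le_mult flip: zero_ereal_def)
  next
    case False
    then have cI: "card I > 0" using F I by (auto simp: card_gt_0_iff)
    show ?thesis
    proof (cases "linf_norm M f")
      case (real r)
      have r: "r \<ge> 0" using linf_norm_nonneg[OF f] real by simp
      have ae: "AE \<omega> in M. (cmod (f \<omega>))\<^sup>2 \<le> r\<^sup>2"
        using esssup_AE[of "\<lambda>\<omega>. ereal (cmod (f \<omega>))" M]
        unfolding real[unfolded linf_norm_def] by eventually_elim (auto intro: power_mono)
      have i: "integrable M (\<lambda>\<omega>. (cmod (f \<omega>))\<^sup>2)"
        by (rule integrable_const_bound[where B = "r\<^sup>2"]) (use ae in auto)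
      have "(\<Sum>k\<in>F. (cmod (x k))\<^sup>2) = (LINT \<omega>|M. (cmod (f \<omega>))\<^sup>2)"
        using l2 unfolding integral_complex_of_real of_real_eq_iff by (rule sym)
      also have "\<dots> \<le> r\<^sup>2"
        using integral_mono_AE[OF i, of "\<lambda>_. r\<^sup>2"] ae by (simp add: prob_space)
      finally have "sqrt (\<Sum>k\<in>F. (cmod (x k))\<^sup>2) \<le> r"
        using r by (simp add: real_le_lsqrt sum_nonneg)
      then have "(\<Sum>k\<in>F. cmod (x k)) \<le> sqrt (card I) * r"
        using cs by (meson mult_left_mono order_trans real_sqrt_ge_zero of_nat_0_le_iff)
      then show ?thesis using real by (simp add: f_def[abs_def])
    next
      case PInf
      then show ?thesis using cI by (simp add: f_def[abs_def])
    qed (use linf_norm_nonneg[OF f] in simp)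
  qed
qed

text \<open>Any combination with a small supremum gives a lower bound for the Sidon constants. The maximum
with 0 covers a negative \<open>C\<close>, for which a larger \<open>K\<close> would lower the right-hand side.\<close>

lemma (in prob_space) sidon_bound_ge:
  assumes "sidon_bound M I \<psi> C" and F: "finite F" "F \<subseteq> I"
    and meas: "\<And>k. k \<in> F \<Longrightarrow> \<psi> k \<in> borel_measurable M"
    and K: "\<And>\<omega>. \<omega> \<in> space M \<Longrightarrow> cmod (\<Sum>k\<in>F. x k * \<psi> k \<omega>) \<le> K"
  shows "(\<Sum>k\<in>F. cmod (x k)) \<le> max 0 C * K"
proof -
  define f where "f \<omega> = (\<Sum>k\<in>F. x k * \<psi> k \<omega>)" for \<omega>
  have f[measurable]: "f \<in> borel_measurable M"
    unfolding f_def using meas by (intro borel_measurable_sum borel_measurable_times) auto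
  have up: "linf_norm M f \<le> ereal K"
    unfolding linf_norm_def by (intro esssup_I AE_I2) (use K in \<open>simp_all add: f_def[symmetric]\<close>)
  with linf_norm_nonneg[OF f] obtain r where r: "linf_norm M f = ereal r" "0 \<le> r" "r \<le> K"
    by (cases "linf_norm M f") auto
  have "(\<Sum>k\<in>F. cmod (x k)) \<le> C * r"
    using assms(1)[unfolded sidon_bound_def, rule_format, of F x] F r(1)
    by (simp add: f_def[abs_def])
  also have "\<dots> \<le> max 0 C * K"
    using r by (intro mult_mono) auto
  finally show ?thesis .
qed

lemma sidon_bound_subset: "sidon_bound M I \<psi> C \<Longrightarrow> J \<subseteq> I \<Longrightarrow> sidon_bound M J \<psi> C"
  unfolding sidon_bound_def by blast

section \<open>Rademacher signs and a clock\<close>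

text \<open>Coordinate 0 is the clock, uniform on the unit interval; the others are the signs. They get a law
on the two-point space, so that the coordinates are signs at every point and not just almost surely.\<close>

definition coordinate_law :: "nat \<Rightarrow> real measure" where
  "coordinate_law i = (if i = 0 then uniform_measure lborel {0..1} else uniform_count_measure {-1, 1})"

abbreviation coin_space :: "(nat \<Rightarrow> real) measure" where
  "coin_space \<equiv> PiM UNIV coordinate_law"

lemma prob_space_coordinate_law: "prob_space (coordinate_law i)"
  by (auto simp: coordinate_law_def intro!: prob_space_uniform_measure prob_space_uniform_count_measure)

interpretation coin: prob_space coin_space
  by (rule prob_space_PiM) (rule prob_space_coordinate_law)

lemma product_prob_space_coordinate_law: "product_prob_space coordinate_law"
proof -
  interpret prob_space "coordinate_law i" for i by (rule prob_space_coordinate_law)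
  show ?thesis by unfold_locales
qed

lemma coin_sign: "\<omega> \<in> space coin_space \<Longrightarrow> n \<ge> 1 \<Longrightarrow> \<omega> n \<in> {-1, 1}"
  using PiE_mem[of \<omega> UNIV "\<lambda>i. space (coordinate_law i)" n]
  by (simp add: space_PiM coordinate_law_def space_uniform_count_measure)

lemma coordinate_measurable[measurable]: "(\<lambda>\<omega>. \<omega> i) \<in> borel_measurable coin_space"
proof -
  have "(\<lambda>x. x) \<in> borel_measurable (coordinate_law i)"
  proof (cases "i = 0")
    case True
    then show ?thesis by (simp add: coordinate_law_def)
  next
    case False
    then have eq: "sets (coordinate_law i) = sets (count_space {-1, 1})"
      by (simp add: coordinate_law_def sets_uniform_count_measure)
    show ?thesis unfolding measurable_cong_sets[OF eq refl] by simp
  qed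
  then show ?thesis
    by (rule measurable_compose[OF measurable_component_singleton[OF UNIV_I]])
qed

lemma coordinate_le_sets[measurable]: "{\<omega> \<in> space coin_space. \<omega> i \<le> c} \<in> sets coin_space"
  by measurable

definition flip :: "nat \<Rightarrow> (nat \<Rightarrow> real) \<Rightarrow> nat \<Rightarrow> real" where
  "flip k \<omega> = fun_upd \<omega> k (- \<omega> k)"

lemma flip_same: "flip k \<omega> k = - \<omega> k" and flip_other: "i \<noteq> k \<Longrightarrow> flip k \<omega> i = \<omega> i"
  by (simp_all add: flip_def)

lemma
  assumes k: "k \<ge> 1"
  shows distr_flip: "distr coin_space coin_space (flip k) = coin_space"
    and measurable_flip: "flip k \<in> measurable coin_space coin_space"
proof -
  have M: "coordinate_law k = uniform_count_measure {-1, 1}"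
    using k by (simp add: coordinate_law_def)
  have u: "uminus \<in> measurable (coordinate_law k) (coordinate_law k)"
    by (auto simp: M measurable_def sets_uniform_count_measure space_uniform_count_measure)
  have "distr (coordinate_law k) (coordinate_law k) uminus = coordinate_law k"
  proof (rule measure_eqI)
    fix X assume "X \<in> sets (distr (coordinate_law k) (coordinate_law k) uminus)"
    then have X: "X \<in> sets (coordinate_law k)" "X \<subseteq> {-1, 1}"
      by (auto simp: M sets_uniform_count_measure)
    have "card (uminus -` X \<inter> {-1, 1}) = card X"
    proof -
      have "uminus -` X \<inter> {-1, 1} = uminus ` X" using X(2) by force
      then show ?thesis by (simp add: card_image)
    qed
    then show "emeasure (distr (coordinate_law k) (coordinate_law k) uminus) X = emeasure (coordinate_law k) X"
      using X u by (simp add: emeasure_distr)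
        (simp add: M space_uniform_count_measure emeasure_uniform_count_measure)
  qed simp
  from product_prob_space.distr_PiM_update_coordinate[OF product_prob_space_coordinate_law UNIV_I u this]
  show "distr coin_space coin_space (flip k) = coin_space"
    by (simp add: flip_def[abs_def])
  show "flip k \<in> measurable coin_space coin_space"
    unfolding flip_def[abs_def]
    by (rule measurable_fun_upd[where J = UNIV])
      (use u in \<open>auto intro: measurable_PiM_component_rev\<close>)
qed

lemma flip_space: "k \<ge> 1 \<Longrightarrow> \<omega> \<in> space coin_space \<Longrightarrow> flip k \<omega> \<in> space coin_space"
  using measurable_space[OF measurable_flip] .

text \<open>Changing the sign of coordinate \<open>k\<close> preserves the measure and negates the integrand.\<close>

lemma integral_flip_invariant_mult_coordinate:
  assumes k: "k \<ge> 1" and [measurable]: "g \<in> borel_measurable coin_space"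
    and inv: "\<And>\<omega>. \<omega> \<in> space coin_space \<Longrightarrow> g (flip k \<omega>) = g \<omega>"
  shows "(\<integral>\<omega>. g \<omega> * \<omega> k \<partial>coin_space) = (0 :: real)"
proof -
  note measurable_flip[OF k, measurable]
  have "(\<integral>\<omega>. g \<omega> * \<omega> k \<partial>coin_space) = (\<integral>\<omega>. g \<omega> * \<omega> k \<partial>distr coin_space coin_space (flip k))"
    by (simp add: distr_flip[OF k])
  also have "\<dots> = (\<integral>\<omega>. g (flip k \<omega>) * flip k \<omega> k \<partial>coin_space)"
    by (rule integral_distr) measurable
  also have "\<dots> = (\<integral>\<omega>. - (g \<omega> * \<omega> k) \<partial>coin_space)"
    using inv by (intro Bochner_Integration.integral_cong) (auto simp: flip_same)
  finally show ?thesis by simp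
qed

text \<open>The events described by the clock and the first \<open>n\<close> signs are invariant under each later sign
change. Taking all invariant events for the past makes measurability a pointwise check, and the martingale property becomes the symmetry
argument of \<open>integral_flip_invariant_mult_coordinate\<close>. The clock is never flipped and so belongs to
every past.\<close>

definition past :: "nat \<Rightarrow> (nat \<Rightarrow> real) measure" where
  "past n = sigma (space coin_space)
    {E \<in> sets coin_space. \<forall>k>n. \<forall>\<omega>\<in>space coin_space. flip k \<omega> \<in> E \<longleftrightarrow> \<omega> \<in> E}"

lemma space_past: "space (past n) = space coin_space"
  by (simp add: past_def space_measure_of_conv)

text \<open>The invariant events already form a \<open>\<sigma>\<close>-algebra.\<close>

lemma sets_past:
  "sets (past n) = {E \<in> sets coin_space. \<forall>k>n. \<forall>\<omega>\<in>space coin_space. flip k \<omega> \<in> E \<longleftrightarrow> \<omega> \<in> E}"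
    (is "_ = ?S")
proof -
  have "sigma_algebra (space coin_space) ?S"
    unfolding sigma_algebra_iff2
    using sets.sets_into_space[of _ coin_space] flip_space by (auto simp: subset_iff)
  then show ?thesis
    unfolding past_def by (rule sigma_algebra.sets_measure_of_eq)
qed

lemma measurable_pastI:
  assumes "f \<in> borel_measurable coin_space"
    and "\<And>k \<omega>. k > n \<Longrightarrow> \<omega> \<in> space coin_space \<Longrightarrow> f (flip k \<omega>) = f \<omega>"
  shows "f \<in> borel_measurable (past n)"
proof (rule measurableI)
  fix X :: "'a set" assume "X \<in> sets borel"
  then show "f -` X \<inter> space (past n) \<in> sets (past n)"
    using assms flip_space measurable_sets[OF assms(1)] by (auto simp: sets_past space_past)
qed simp

text \<open>A predictable choice of signs \<open>h\<close>, multiplied into the independent signs, gives again a martingale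
difference sequence: \<open>h n\<close> is invariant under the sign changes from \<open>n\<close> on, so the \<open>n\<close>-th product is
odd in coordinate \<open>n\<close>.\<close>

lemma sign_martingale_coin:
  assumes [measurable]: "\<And>n. h n \<in> borel_measurable coin_space"
    and h: "\<And>n \<omega>. n \<ge> 1 \<Longrightarrow> \<omega> \<in> space coin_space \<Longrightarrow> h n \<omega> \<in> {-1, 1}"
    and inv: "\<And>n k \<omega>. 1 \<le> n \<Longrightarrow> n \<le> k \<Longrightarrow> \<omega> \<in> space coin_space \<Longrightarrow> h n (flip k \<omega>) = h n \<omega>"
  shows "sign_martingale coin_space past (\<lambda>n \<omega>. h n \<omega> * \<omega> n)"
proof
  show "subalgebra coin_space (past n)" for n
    by (auto simp: subalgebra_def space_past sets_past)
  show "sets (past m) \<subseteq> sets (past n)" if "m \<le> n" for m n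
    using that by (auto simp: sets_past)
  fix n :: nat assume n: "n \<ge> 1"
  show "(\<lambda>\<omega>. h n \<omega> * \<omega> n) \<in> borel_measurable (past n)"
    by (rule measurable_pastI) (use n in \<open>auto simp: inv flip_other\<close>)
  show "h n \<omega> * \<omega> n \<in> {-1, 1}" if "\<omega> \<in> space coin_space" for \<omega>
    using h[OF n that] coin_sign[OF that n] by auto
  fix E assume E: "E \<in> sets (past (n - 1))"
  have [measurable]: "E \<in> sets coin_space" using E by (simp add: sets_past)
  have "(\<integral>\<omega>. (indicator E \<omega> * h n \<omega>) * \<omega> n \<partial>coin_space) = 0"
    by (rule integral_flip_invariant_mult_coordinate[OF n])
      (use n E in \<open>auto simp: inv sets_past indicator_def\<close>)
  then show "(\<integral>\<omega>. indicator E \<omega> * (h n \<omega> * \<omega> n) \<partial>coin_space) = 0"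
    by (simp add: mult.assoc)
qed

section \<open>The walk that rests when it is far out\<close>

text \<open>The probability of the part of \<open>B\<close> with clock at most \<open>c\<close> is continuous in \<open>c\<close>, even Lipschitz,
since the clock is uniform; it climbs from 0 to the probability of \<open>B\<close>, so it takes the value one half.
The event \<open>B\<close> may itself depend on the clock, as the later ones do through the earlier cuts.\<close>

lemma ex_halving_cut:
  assumes B[measurable]: "B \<in> sets coin_space" and half: "coin.prob B \<ge> 1 / 2"
  shows "\<exists>c. coin.prob (B \<inter> {\<omega> \<in> space coin_space. \<omega> 0 \<le> c}) = 1 / 2"
proof -
  define F where "F c = coin.prob (B \<inter> {\<omega> \<in> space coin_space. \<omega> 0 \<le> c})" for c
  have law: "coin.prob {\<omega> \<in> space coin_space. \<omega> 0 \<in> X} = measure lborel ({0..1} \<inter> X)"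
    if "X \<in> sets borel" for X
  proof -
    have "coin.prob {\<omega> \<in> space coin_space. \<omega> 0 \<in> X} = measure (coordinate_law 0) X"
      using product_prob_space.emeasure_PiM_Collect_single[OF product_prob_space_coordinate_law, of 0 UNIV X] that
      by (simp add: measure_def coordinate_law_def)
    then show ?thesis using that by (simp add: coordinate_law_def)
  qed
  have F_mono: "F a \<le> F b" if "a \<le> b" for a b
    unfolding F_def using that by (intro coin.finite_measure_mono) auto
  have F_lip: "F b - F a \<le> b - a" if "a \<le> b" for a b
  proof -
    have "F b \<le> coin.prob ((B \<inter> {\<omega> \<in> space coin_space. \<omega> 0 \<le> a}) \<union> {\<omega> \<in> space coin_space. \<omega> 0 \<in> {a<..b}})"
      unfolding F_def by (intro coin.finite_measure_mono) auto
    also have "\<dots> \<le> F a + coin.prob {\<omega> \<in> space coin_space. \<omega> 0 \<in> {a<..b}}"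
      unfolding F_def by (intro measure_Un_le) auto
    also have "coin.prob {\<omega> \<in> space coin_space. \<omega> 0 \<in> {a<..b}} = measure lborel ({0..1} \<inter> {a<..b})"
      by (rule law) simp
    also have "measure lborel ({0..1} \<inter> {a<..b}) \<le> measure lborel {a<..b}"
      using that by (intro measure_mono_fmeasurable fmeasurableI) auto
    finally show ?thesis using that by simp
  qed
  have "\<bar>F a - F b\<bar> \<le> \<bar>a - b\<bar>" for a b
    using F_lip[of a b] F_lip[of b a] F_mono[of a b] F_mono[of b a] by (cases "a \<le> b") auto
  then have "1-lipschitz_on {0..1} F"
    by (intro lipschitz_onI) (auto simp: dist_real_def)
  then have cont: "continuous_on {0..1} F"
    by (rule lipschitz_on_continuous_on)
  have "F 0 \<le> coin.prob {\<omega> \<in> space coin_space. \<omega> 0 \<in> {..0}}"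
    unfolding F_def by (intro coin.finite_measure_mono) auto
  also have "\<dots> = 0"
  proof (subst law)
    have "{0..1} \<inter> {..0} = {0::real}" by auto
    then show "measure lborel ({0..1} \<inter> {..0::real}) = 0" by simp
  qed simp
  finally have F0: "F 0 \<le> 1 / 2" by simp
  have "coin.prob B \<le> coin.prob ((B \<inter> {\<omega> \<in> space coin_space. \<omega> 0 \<le> 1}) \<union> {\<omega> \<in> space coin_space. \<omega> 0 \<in> {1<..}})"
    using sets.sets_into_space[OF B] by (intro coin.finite_measure_mono) auto
  also have "\<dots> \<le> F 1 + coin.prob {\<omega> \<in> space coin_space. \<omega> 0 \<in> {1<..}}"
    unfolding F_def by (intro measure_Un_le) auto
  also have "coin.prob {\<omega> \<in> space coin_space. \<omega> 0 \<in> {1<..}} = 0"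
  proof (subst law)
    have "{0..1} \<inter> {1<..} = ({} :: real set)" by auto
    then show "measure lborel ({0..1} \<inter> {1::real<..}) = 0" by simp
  qed simp
  finally have F1: "1 / 2 \<le> F 1" using half by simp
  show ?thesis
    using IVT'[OF F0 F1 _ cont] by (auto simp: F_def)
qed

text \<open>The \<open>n\<close>-th step starts from the position \<open>T\<close> reached after \<open>n - 1\<close> steps. The factor 2 is
large enough for the Chebyshev inequality to make this event likely.\<close>

definition calm :: "nat \<Rightarrow> ((nat \<Rightarrow> real) \<Rightarrow> real) \<Rightarrow> (nat \<Rightarrow> real) set" where
  "calm n T = {\<omega> \<in> space coin_space. \<bar>T \<omega>\<bar> < 2 * sqrt n}"

definition halving_cut :: "(nat \<Rightarrow> real) set \<Rightarrow> real" where
  "halving_cut B = (SOME c. coin.prob (B \<inter> {\<omega> \<in> space coin_space. \<omega> 0 \<le> c}) = 1 / 2)"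

definition moving :: "nat \<Rightarrow> ((nat \<Rightarrow> real) \<Rightarrow> real) \<Rightarrow> (nat \<Rightarrow> real) set" where
  "moving n T = calm n T \<inter> {\<omega> \<in> space coin_space. \<omega> 0 \<le> halving_cut (calm n T)}"

text \<open>The walk is defined as a function on the whole space at once, because the cut for the next step
depends on the law of the present position.\<close>

primrec walk :: "nat \<Rightarrow> (nat \<Rightarrow> real) \<Rightarrow> real" where
  "walk 0 = (\<lambda>\<omega>. 0)"
| "walk (Suc n) = (\<lambda>\<omega>. walk n \<omega> + indicator (moving (Suc n) (walk n)) \<omega> * \<omega> (Suc n))"

definition agree :: "nat \<Rightarrow> (nat \<Rightarrow> real) set" where
  "agree n = moving n (walk (n - 1))"

lemma walk_Suc: "walk (Suc n) \<omega> = walk n \<omega> + indicator (agree (Suc n)) \<omega> * \<omega> (Suc n)"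
  by (simp add: agree_def)

lemma calm_sets:
  assumes [measurable]: "T \<in> borel_measurable coin_space"
  shows "calm n T \<in> sets coin_space"
  unfolding calm_def by measurable

lemma moving_sets: "T \<in> borel_measurable coin_space \<Longrightarrow> moving n T \<in> sets coin_space"
  unfolding moving_def by (intro sets.Int calm_sets coordinate_le_sets)

lemma walk_measurable[measurable]: "walk n \<in> borel_measurable coin_space"
proof (induction n)
  case (Suc n)
  note Suc[measurable] moving_sets[OF Suc, measurable]
  show ?case by simp
qed simp

lemma agree_sets[measurable]: "agree n \<in> sets coin_space"
  unfolding agree_def by (rule moving_sets) measurable

lemma moving_flip:
  assumes "k \<ge> 1" "\<omega> \<in> space coin_space" "T (flip k \<omega>) = T \<omega>"
  shows "flip k \<omega> \<in> moving n T \<longleftrightarrow> \<omega> \<in> moving n T"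
  using assms flip_space[of k \<omega>] by (auto simp: moving_def calm_def flip_other)

lemma walk_flip: "\<omega> \<in> space coin_space \<Longrightarrow> n < k \<Longrightarrow> walk n (flip k \<omega>) = walk n \<omega>"
  by (induction n) (auto simp: moving_flip flip_other indicator_def)

lemma agree_flip:
  "\<omega> \<in> space coin_space \<Longrightarrow> 1 \<le> n \<Longrightarrow> n \<le> k \<Longrightarrow> flip k \<omega> \<in> agree n \<longleftrightarrow> \<omega> \<in> agree n"
  unfolding agree_def by (rule moving_flip) (auto simp: walk_flip)

text \<open>A step of size 1 is made only from a position below \<open>2 * sqrt (n + 1)\<close>; a resting walk keeps a
bound that increases with \<open>n\<close>.\<close>

lemma walk_bound: "\<omega> \<in> space coin_space \<Longrightarrow> \<bar>walk n \<omega>\<bar> \<le> 2 * sqrt n + 1"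
proof (induction n)
  case (Suc n)
  show ?case
  proof (cases "\<omega> \<in> agree (Suc n)")
    case True
    then have "\<bar>walk n \<omega>\<bar> < 2 * sqrt (Suc n)"
      by (simp add: agree_def moving_def calm_def)
    moreover have "\<bar>\<omega> (Suc n)\<bar> = 1"
      using coin_sign[OF Suc.prems, of "Suc n"] by auto
    ultimately show ?thesis
      using True by (simp add: walk_Suc del: walk.simps)
  next
    case False
    have "sqrt n \<le> sqrt (Suc n)" by simp
    then show ?thesis
      using Suc False by (simp add: walk_Suc del: walk.simps of_nat_Suc real_sqrt_le_iff)
  qed
qed simp

lemma integrable_walk_sq: "integrable coin_space (\<lambda>\<omega>. (walk n \<omega>)\<^sup>2)"
proof (rule coin.integrable_const_bound)
  show "AE \<omega> in coin_space. norm ((walk n \<omega>)\<^sup>2) \<le> (2 * sqrt n + 1)\<^sup>2"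
    using walk_bound[of _ n] by (intro AE_I2) (simp add: abs_le_square_iff[symmetric])
qed measurable

text \<open>The steps are orthogonal to the position from which they start, and each has second moment at
most 1.\<close>

lemma expectation_walk_sq: "coin.expectation (\<lambda>\<omega>. (walk n \<omega>)\<^sup>2) \<le> n"
proof (induction n)
  case (Suc n)
  \<comment> \<open>The cross term of the square is \<open>?g \<omega> * \<omega> (Suc n)\<close>.\<close>
  let ?I = "indicator (agree (Suc n)) :: (nat \<Rightarrow> real) \<Rightarrow> real"
  let ?g = "\<lambda>\<omega>. 2 * walk n \<omega> * ?I \<omega>"
  have odd: "(\<integral>\<omega>. ?g \<omega> * \<omega> (Suc n) \<partial>coin_space) = 0"
    by (rule integral_flip_invariant_mult_coordinate)
      (auto simp: walk_flip agree_flip indicator_def simp del: walk.simps)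
  have i: "integrable coin_space (\<lambda>\<omega>. ?g \<omega> * \<omega> (Suc n))"
  proof (rule coin.integrable_const_bound)
    show "AE \<omega> in coin_space. norm (?g \<omega> * \<omega> (Suc n)) \<le> 2 * (2 * sqrt n + 1)"
    proof (rule AE_I2)
      fix \<omega> assume \<omega>: "\<omega> \<in> space coin_space"
      then show "norm (?g \<omega> * \<omega> (Suc n)) \<le> 2 * (2 * sqrt n + 1)"
        using walk_bound[OF \<omega>, of n] coin_sign[OF \<omega>, of "Suc n"] 
        by (auto simp: indicator_def abs_mult simp del: walk.simps)
    qed
  qed measurable
  have "coin.expectation (\<lambda>\<omega>. (walk (Suc n) \<omega>)\<^sup>2)
      \<le> coin.expectation (\<lambda>\<omega>. ((walk n \<omega>)\<^sup>2 + ?g \<omega> * \<omega> (Suc n)) + 1)"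
  proof (rule integral_mono)
    fix \<omega> assume \<omega>: "\<omega> \<in> space coin_space"
    have "\<omega> (Suc n) * \<omega> (Suc n) = 1" using coin_sign[OF \<omega>, of "Suc n"] by auto
    then show "(walk (Suc n) \<omega>)\<^sup>2 \<le> ((walk n \<omega>)\<^sup>2 + ?g \<omega> * \<omega> (Suc n)) + 1"
      by (simp add: walk_Suc indicator_def power2_eq_square algebra_simps del: walk.simps)
  qed (use i integrable_walk_sq in \<open>auto simp del: walk.simps\<close>)
  also have "\<dots> = coin.expectation (\<lambda>\<omega>. (walk n \<omega>)\<^sup>2) + 0 + 1"
    using i integrable_walk_sq odd by (simp add: coin.prob_space del: walk.simps)
  finally show ?case using Suc by simp
qed simp

text \<open>Chebyshev inequality: the complement has probability at most \<open>n / (4 * (n + 1))\<close>.\<close>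

lemma prob_calm_walk: "coin.prob (calm (Suc n) (walk n)) \<ge> 1 / 2"
proof -
  let ?B = "calm (Suc n) (walk n)"
  have S[measurable]: "?B \<in> sets coin_space"
    by (rule calm_sets[OF walk_measurable])
  have i: "integrable coin_space (indicator ?B :: _ \<Rightarrow> real)"
    by (rule integrable_real_indicator[OF S]) (simp add: coin.emeasure_eq_measure)
  have "4 * real (Suc n) * (1 - coin.prob ?B)
      = coin.expectation (\<lambda>\<omega>. 4 * real (Suc n) * (1 - indicator ?B \<omega>))"
    using S i by (simp add: coin.prob_space)
  also have "\<dots> \<le> coin.expectation (\<lambda>\<omega>. (walk n \<omega>)\<^sup>2)"
  proof (rule integral_mono)
    fix \<omega> assume \<omega>: "\<omega> \<in> space coin_space"
    have "4 * real (Suc n) \<le> (walk n \<omega>)\<^sup>2" if "2 * sqrt (Suc n) \<le> \<bar>walk n \<omega>\<bar>"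
    proof -
      have "(2 * sqrt (Suc n))\<^sup>2 \<le> \<bar>walk n \<omega>\<bar>\<^sup>2"
        using that by (intro power_mono) auto
      then show ?thesis by (simp add: power_mult_distrib del: of_nat_Suc)
    qed
    then show "4 * real (Suc n) * (1 - indicator ?B \<omega>) \<le> (walk n \<omega>)\<^sup>2"
      using \<omega> by (auto simp: calm_def indicator_def not_less simp del: of_nat_Suc)
  qed (use i in \<open>auto simp: integrable_walk_sq\<close>)
  also have "\<dots> \<le> real (Suc n)"
    using expectation_walk_sq[of n] by simp
  finally have "4 * (1 - coin.prob ?B) \<le> 1"
    by (simp add: mult.assoc mult.left_commute[of 4] del: of_nat_Suc)
  then show ?thesis by simp
qed

lemma prob_agree:
  assumes "n \<ge> 1"
  shows "coin.prob (agree n) = 1 / 2"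
proof -
  obtain m where m: "n = Suc m" using assms by (cases n) auto
  show ?thesis
    unfolding agree_def moving_def halving_cut_def m
    using someI_ex[OF ex_halving_cut[OF calm_sets[OF walk_measurable] prob_calm_walk]] by simp
qed

definition plus_sign :: "nat \<Rightarrow> (nat \<Rightarrow> real) \<Rightarrow> real" where
  "plus_sign n \<omega> = \<omega> n"

definition minus_sign :: "nat \<Rightarrow> (nat \<Rightarrow> real) \<Rightarrow> real" where
  "minus_sign n \<omega> = (2 * indicator (agree n) \<omega> - 1) * \<omega> n"

lemma sign_martingale_plus: "sign_martingale coin_space past plus_sign"
  using sign_martingale_coin[of "\<lambda>_ _. 1"] by (simp add: plus_sign_def[abs_def])

lemma sign_martingale_minus: "sign_martingale coin_space past minus_sign"
  unfolding minus_sign_def[abs_def]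
  by (rule sign_martingale_coin) (auto simp: indicator_def agree_flip)

text \<open>The product is 1 on \<open>agree n\<close> and -1 off it; this is where probability one half is needed.\<close>

lemma plus_minus_orthogonal:
  assumes "n \<ge> 1"
  shows "(\<integral>\<omega>. plus_sign n \<omega> * minus_sign n \<omega> \<partial>coin_space) = 0"
proof -
  have "(\<integral>\<omega>. plus_sign n \<omega> * minus_sign n \<omega> \<partial>coin_space)
      = (\<integral>\<omega>. 2 * indicator (agree n) \<omega> - 1 \<partial>coin_space)"
    using coin_sign[OF _ assms]
    by (intro Bochner_Integration.integral_cong) (force simp: plus_sign_def minus_sign_def)+
  also have "\<dots> = 2 * coin.prob (agree n) - 1"
    using integrable_real_indicator[OF agree_sets, of n]
    by (simp add: coin.emeasure_eq_measure coin.prob_space)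
  finally show ?thesis
    using prob_agree[OF assms] by simp
qed

lemma sum_plus_minus: "(\<Sum>k=1..n. plus_sign k \<omega> + minus_sign k \<omega>) = 2 * walk n \<omega>"
  by (induction n) (simp_all add: walk_Suc plus_sign_def minus_sign_def algebra_simps del: walk.simps(2))

section \<open>The union of the two sequences\<close>

definition union_system :: "nat + nat \<Rightarrow> (nat \<Rightarrow> real) \<Rightarrow> complex" where
  "union_system = case_sum (\<lambda>n \<omega>. of_real (plus_sign n \<omega>)) (\<lambda>n \<omega>. of_real (minus_sign n \<omega>))"

lemma union_system_orthonormal: "orthonormal_system coin_space ({1..} <+> {1..}) union_system"
  unfolding union_system_def
  by (rule orthonormal_system_sign_pair[OF sign_martingale_plus sign_martingale_minus plus_minus_orthogonal])

lemma union_system_measurable: "k \<in> {1..} <+> {1..} \<Longrightarrow> union_system k \<in> borel_measurable coin_space"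
  using union_system_orthonormal by (auto simp: orthonormal_system_def)

text \<open>All coefficients are 1: their sum is \<open>2 * n\<close>, while the combination is twice the walk and hence
bounded by \<open>2 * (2 * sqrt n + 1) \<le> 6 * sqrt n\<close>.\<close>

lemma sidon_bound_union_ge:
  assumes C: "sidon_bound coin_space ({1..n} <+> {1..n}) union_system C" and n: "n \<ge> 1"
  shows "sqrt n / 3 \<le> C"
proof -
  let ?I = "{1..n} <+> {1..n} :: (nat + nat) set"
  have K: "cmod (\<Sum>k\<in>?I. 1 * union_system k \<omega>) \<le> 6 * sqrt n" if \<omega>: "\<omega> \<in> space coin_space" for \<omega>
  proof -
    have "(\<Sum>k\<in>?I. 1 * union_system k \<omega>) = of_real (\<Sum>k=1..n. plus_sign k \<omega> + minus_sign k \<omega>)"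
      by (simp add: sum.Plus union_system_def sum.distrib)
    also have "cmod \<dots> = 2 * \<bar>walk n \<omega>\<bar>"
      by (simp only: norm_of_real sum_plus_minus)
    also have "\<dots> \<le> 2 * (2 * sqrt n + 1)"
      using walk_bound[OF \<omega>, of n] by simp
    also have "\<dots> \<le> 6 * sqrt n"
      using n by simp
    finally show ?thesis .
  qed
  have "(\<Sum>k\<in>?I. cmod 1) \<le> max 0 C * (6 * sqrt n)"
    by (rule coin.sidon_bound_ge[OF C _ _ _ K]) (auto intro: union_system_measurable)
  then have "2 * real n \<le> max 0 C * (6 * sqrt n)"
    by (simp add: card_Plus)
  moreover have "2 * real n = 2 * sqrt n * sqrt n" by simp
  ultimately have "2 * sqrt n * sqrt n \<le> (6 * max 0 C) * sqrt n"
    by (simp add: mult_ac)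
  then have "2 * sqrt n \<le> 6 * max 0 C"
    using n by (simp del: real_sqrt_mult_self)
  moreover have "sqrt n \<ge> 1" using n by simp
  ultimately show ?thesis by (auto simp: max_def split: if_splits)
qed

lemma union_system_not_sidon: "\<not> sidon_system coin_space ({1..} <+> {1..}) union_system"
proof
  assume "sidon_system coin_space ({1..} <+> {1..}) union_system"
  then obtain C where C: "sidon_bound coin_space ({1..} <+> {1..}) union_system C"
    by (auto simp: sidon_system_def)
  obtain m :: nat where m: "(3 * C)\<^sup>2 < m" using reals_Archimedean2 by blast
  have "sqrt (Suc m) / 3 \<le> C"
    by (rule sidon_bound_union_ge[OF sidon_bound_subset[OF C]]) auto
  then have "sqrt (Suc m) \<le> 3 * C" by simp
  then have "real (Suc m) \<le> (3 * C)\<^sup>2"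
    using sqrt_le_D by blast
  with m show False by simp
qed

lemma union_system_sidon_bound:
  "sidon_bound coin_space ({1..n} <+> {1..n}) union_system (sqrt 2 * sqrt n)"
proof -
  have "orthonormal_system coin_space ({1..n} <+> {1..n}) union_system"
    by (rule orthonormal_system_compose[OF union_system_orthonormal, where f = "\<lambda>k. k"]) auto
  from coin.sidon_bound_orthonormal[OF this] show ?thesis
    by (simp add: card_Plus real_sqrt_mult[symmetric])
qed

lemma union_system_sidon: "sidon_system coin_space ({1..n} <+> {1..n}) union_system"
  using union_system_sidon_bound by (auto simp: sidon_system_def)

lemma union_system_sidon_constant:
  assumes n: "n \<ge> 1"
  defines "S \<equiv> sidon_constant coin_space ({1..n} <+> {1..n}) union_system"
  shows "sqrt n / 3 \<le> S" "S \<le> sqrt 2 * sqrt n"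
proof -
  have fin: "union_system k ` space coin_space \<subseteq> {-1, 1}" if "k \<in> {1..n} <+> {1..n}" for k
    using that sign_martingale.sign[OF sign_martingale_plus] sign_martingale.sign[OF sign_martingale_minus]
    by (fastforce simp: union_system_def)
  have "bounded (union_system k ` space coin_space)" if "k \<in> {1..n} <+> {1..n}" for k
    by (rule bounded_subset[OF _ fin[OF that]]) simp
  note least = coin.sidon_constant_least[of "{1..n} <+> {1..n}" union_system, folded S_def,
      OF union_system_measurable this union_system_sidon]
  show "sqrt n / 3 \<le> S"
    by (rule sidon_bound_union_ge[OF least(1) n]) (use n in auto)
  show "S \<le> sqrt 2 * sqrt n"
    by (rule least(2)[OF _ _ _ union_system_sidon_bound]) (use n in auto)
qed

theorem corollary5:
  shows "\<exists>(M :: (nat \<Rightarrow> real) measure) (\<phi>p :: nat \<Rightarrow> (nat \<Rightarrow> real) \<Rightarrow> complex)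
            (\<phi>m :: nat \<Rightarrow> (nat \<Rightarrow> real) \<Rightarrow> complex).
    prob_space M \<and>
    orthonormal_system M {1..} \<phi>p \<and> martingale_difference_sequence M \<phi>p \<and>
    orthonormal_system M {1..} \<phi>m \<and> martingale_difference_sequence M \<phi>m \<and>
    (\<forall>f \<in> linear_span {1..} \<phi>p. \<forall>g \<in> linear_span {1..} \<phi>m. l2_inner M f g = 0) \<and>
    rademacher_distributed M \<phi>p \<and> rademacher_distributed M \<phi>m \<and>
    \<not> sidon_system M ({1..} <+> {1..}) (case_sum \<phi>p \<phi>m) \<and>
    (\<forall>n\<ge>1. sidon_system M ({1..n} <+> {1..n}) (case_sum \<phi>p \<phi>m)) \<and>
    (\<exists>c c' :: real. 0 < c \<and> c \<le> c' \<and>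
       (\<forall>n\<ge>1. c * sqrt (real n) \<le> sidon_constant M ({1..n} <+> {1..n}) (case_sum \<phi>p \<phi>m) \<and>
               sidon_constant M ({1..n} <+> {1..n}) (case_sum \<phi>p \<phi>m) \<le> c' * sqrt (real n)))"
proof -
  let ?p = "\<lambda>n \<omega>. complex_of_real (plus_sign n \<omega>)" and ?m = "\<lambda>n \<omega>. complex_of_real (minus_sign n \<omega>)"
  interpret p: sign_martingale coin_space past plus_sign by (rule sign_martingale_plus)
  interpret m: sign_martingale coin_space past minus_sign by (rule sign_martingale_minus)
  have on: "orthonormal_system coin_space ({1..} <+> {1..}) (case_sum ?p ?m)"
    using union_system_orthonormal by (simp only: union_system_def)
  have on_p: "orthonormal_system coin_space {1..} ?p" and on_m: "orthonormal_system coin_space {1..} ?m"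
    using orthonormal_system_compose[OF on, of Inl "{1..}"] orthonormal_system_compose[OF on, of Inr "{1..}"]
    by auto
  have orth: "l2_inner coin_space f g = 0" 
    if fg: "f \<in> linear_span {1..} ?p" "g \<in> linear_span {1..} ?m" for f g
  proof -
    obtain F x where F: "finite F" "F \<subseteq> {1..}" and f: "f = (\<lambda>\<omega>. \<Sum>k\<in>F. x k * ?p k \<omega>)"
      using fg(1) unfolding linear_span_def mem_Collect_eq by (elim exE conjE)
    obtain G y where G: "finite G" "G \<subseteq> {1..}" and g: "g = (\<lambda>\<omega>. \<Sum>k\<in>G. y k * ?m k \<omega>)"
      using fg(2) unfolding linear_span_def mem_Collect_eq by (elim exE conjE)
    have "l2_inner coin_space f g
        = (\<Sum>j\<in>F. \<Sum>k\<in>G. x j * cnj (y k) * l2_inner coin_space (?p j) (?m k))"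
      unfolding f g using on_p on_m F G
      by (intro l2_inner_sum) (auto simp: orthonormal_system_def)
    also have "\<dots> = 0"
    proof (intro sum.neutral ballI)
      fix j k assume "j \<in> F" "k \<in> G"
      then have "Inl j \<in> {1..} <+> {1..}" "Inr k \<in> {1..} <+> {1..}" using F G by auto
      then have "l2_inner coin_space (case_sum ?p ?m (Inl j)) (case_sum ?p ?m (Inr k)) = 0"
        using on unfolding orthonormal_system_def by (metis Inl_Inr_False)
      then show "x j * cnj (y k) * l2_inner coin_space (?p j) (?m k) = 0" by simp
    qed
    finally show ?thesis .
  qed
  have U: "case_sum ?p ?m = union_system"
    by (simp only: union_system_def)
  have "0 < (1 / 3 :: real) \<and> 1 / 3 \<le> sqrt 2 \<and>
      (\<forall>n\<ge>1. 1 / 3 * sqrt (real n) \<le> sidon_constant coin_space ({1..n} <+> {1..n}) union_system \<and>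
             sidon_constant coin_space ({1..n} <+> {1..n}) union_system \<le> sqrt 2 * sqrt (real n))"
    using union_system_sidon_constant real_le_rsqrt[of "1 / 3" 2] by (auto simp: power2_eq_square)
  then have growth: "\<exists>c c' :: real. 0 < c \<and> c \<le> c' \<and>
      (\<forall>n\<ge>1. c * sqrt (real n) \<le> sidon_constant coin_space ({1..n} <+> {1..n}) union_system \<and>
             sidon_constant coin_space ({1..n} <+> {1..n}) union_system \<le> c' * sqrt (real n))"
    by (intro exI)
  show ?thesis
    by (rule exI[of _ coin_space], rule exI[of _ ?p], rule exI[of _ ?m], unfold U)
      (intro conjI ballI allI impI coin.prob_space_axioms on_p on_m orth
        p.martingale_difference_sequence_sign m.martingale_difference_sequence_sign
        p.rademacher_distributed_sign m.rademacher_distributed_sign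
        union_system_not_sidon union_system_sidon growth)
qed

end
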